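(* Let $\mathcal{F}$ be a union-closed family of finite sets with $\emptyset\in\mathcal{F}$, let $U\subseteq\bigcup\mathcal{F}$, and let $\mathcal{F}'$ be an extension of $(\mathcal{F},U)$. Then $\mathcal{F}'$ is also an extension of $(\mathcal{N}^3_{\mathcal{F}}(U),U)$ and $$\mu_{\mathcal{F},\mathcal{F}'}(U)=\mu_{\mathcal{N}^3_{\mathcal{F}}(U),\mathcal{F}'}(U).$$
   Context: For families $\mathcal{A},\mathcal{B}$ of sets, $\mathcal{A}\vee\mathcal{B}=\{A\cup B: A\in\mathcal{A},B\in\mathcal{B}\}$, and for a set $Z$, $\mathcal{A}_{\setminus Z}=\{A\setminus Z:A\in\mathcal{A}\}$. For a union-closed family $\mathcal{K}$ with $\emptyset\in\mathcal{K}$: $J(\mathcal{K})$ is the set of union generators (nonempty $V\in\mathcal{K}$ not equal to the union of the members of $\mathcal{K}$ properly contained in $V$); $\pi_{\mathcal{K}}(X)=\bigcup\{V\in\mathcal{K}:V\subseteq X\}$. For a set $W$, $\mathcal{N}_{\mathcal{F}}(W)$ is the family of all unions of subfamilies of $\{V\in J(\mathcal{F}):V\cap W\neq\emptyset\}$ (empty union $=\emptyset$), and $\mathcal{N}^3_{\mathcal{F}}(U)=\mathcal{N}_{\mathcal{F}}(\bigcup\mathcal{N}_{\mathcal{F}}(U))$. A union-closed family $\mathcal{F}'$ is an extension of $(\mathcal{K},U)$ if $\mathcal{F}'=\mathcal{K}\vee\mathcal{H}$ for a nonempty union-closed family $\mathcal{H}$ with $(\bigcup\mathcal{H})\cap U=\emptyset$.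 For $X$ with $X\cap U=\emptyset$, $E_{\mathcal{K},U}(X)$ is the set of $Y\subseteq U$ with $\pi_{\mathcal{K}}(X\cup Y)\cap U=Y$ and $\pi_{\mathcal{K}}(X\cup Y)\supseteq\pi_{\mathcal{K}}(X\cup U)\setminus U$. For an extension $\mathcal{F}'$ of $(\mathcal{K},U)$, $\mu_{\mathcal{K},\mathcal{F}'}(U)=\sum_{X\in\mathcal{F}'_{\setminus U}}|E_{\mathcal{K},U}(X)|\,/\,|\mathcal{F}'_{\setminus U}|$.
   Formalization: The family F is assumed finite (union-closed meaning closed under pairwise unions); for infinite F the claim fails, e.g. F = the finite sets of naturals containing 0 together with the empty set, U = {0}, F' = F. *)

theory Defs
  imports Complex_Main
begin

definition union_closed :: "'a set set \<Rightarrow> bool" where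
  "union_closed \<K> \<longleftrightarrow> (\<forall>A\<in>\<K>. \<forall>B\<in>\<K>. A \<union> B \<in> \<K>)"

definition fam_join :: "'a set set \<Rightarrow> 'a set set \<Rightarrow> 'a set set" where
  "fam_join \<A> \<B> = {A \<union> B | A B. A \<in> \<A> \<and> B \<in> \<B>}"

definition fam_minus :: "'a set set \<Rightarrow> 'a set \<Rightarrow> 'a set set" where
  "fam_minus \<A> Z = {A - Z | A. A \<in> \<A>}"

definition generators :: "'a set set \<Rightarrow> 'a set set" where
  "generators \<K> = {V \<in> \<K>. V \<noteq> {} \<and> V \<noteq> \<Union>{A \<in> \<K>. A \<subset> V}}"

definition fam_proj :: "'a set set \<Rightarrow> 'a set \<Rightarrow> 'a set" where
  "fam_proj \<K> X = \<Union>{V \<in> \<K>. V \<subseteq> X}"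

definition nbhd :: "'a set set \<Rightarrow> 'a set \<Rightarrow> 'a set set" where
  "nbhd \<F> W = {\<Union>\<S> | \<S>. \<S> \<subseteq> {V \<in> generators \<F>. V \<inter> W \<noteq> {}}}"

definition nbhd3 :: "'a set set \<Rightarrow> 'a set \<Rightarrow> 'a set set" where
  "nbhd3 \<F> U = nbhd \<F> (\<Union>(nbhd \<F> U))"

definition is_extension :: "'a set set \<Rightarrow> 'a set set \<Rightarrow> 'a set \<Rightarrow> bool" where
  "is_extension \<F>' \<K> U \<longleftrightarrow>
     union_closed \<F>' \<and>
     (\<exists>\<H>. \<H> \<noteq> {} \<and> union_closed \<H> \<and> \<Union>\<H> \<inter> U = {} \<and> \<F>' = fam_join \<K> \<H>)"

text \<open>Only meant for \<open>X\<close> disjoint from \<open>U\<close>.\<close>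
definition ext_traces :: "'a set set \<Rightarrow> 'a set \<Rightarrow> 'a set \<Rightarrow> 'a set set" where
  "ext_traces \<K> U X =
     {Y. Y \<subseteq> U \<and> fam_proj \<K> (X \<union> Y) \<inter> U = Y \<and>
         fam_proj \<K> (X \<union> U) - U \<subseteq> fam_proj \<K> (X \<union> Y)}"

text \<open>Only meaningful when \<open>\<F>'\<close> is a finite nonempty family; for infinite
  \<open>fam_minus \<F>' U\<close> it is \<open>0\<close> by the usual conventions on \<open>sum\<close> and \<open>card\<close>.\<close>
definition ext_mean :: "'a set set \<Rightarrow> 'a set set \<Rightarrow> 'a set \<Rightarrow> real" where
  "ext_mean \<K> \<F>' U =
     (\<Sum>X\<in>fam_minus \<F>' U. real (card (ext_traces \<K> U X))) / real (card (fam_minus \<F>' U))"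

end

theory Submission
  imports Defs
begin

text \<open>Split the generators of \<open>\<F>\<close> into those meeting \<open>W = \<Union>\<N>(U)\<close> and those disjoint from it.
  Since \<open>U \<subseteq> W\<close>, unions of the latter can be absorbed into the family \<open>\<H>\<close> of the extension.
  For the means, even the sets of traces agree: a point of a generator meeting \<open>U\<close> lies in \<open>W\<close>,
  so every generator through it belongs to \<open>\<N>\<^sup>3(U)\<close>, whereas a generator contained in
  \<open>X \<union> U\<close> but disjoint from \<open>U\<close> is contained in \<open>X\<close> already.\<close>

lemma union_closed_Union:
  assumes "union_closed \<K>" "{} \<in> \<K>" "finite \<S>" "\<S> \<subseteq> \<K>"
  shows "\<Union>\<S> \<in> \<K>"
  using assms(3,4)
  by (induction \<S> rule: finite_induct) (use assms(1,2) in \<open>auto simp: union_closed_def\<close>)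

lemma union_closed_fam_join:
  assumes "union_closed \<A>" "union_closed \<B>"
  shows "union_closed (fam_join \<A> \<B>)"
  unfolding union_closed_def
proof (intro ballI)
  fix X Y assume "X \<in> fam_join \<A> \<B>" "Y \<in> fam_join \<A> \<B>"
  then obtain A B A' B' where "A \<in> \<A>" "B \<in> \<B>" "X = A \<union> B" "A' \<in> \<A>" "B' \<in> \<B>" "Y = A' \<union> B'"
    unfolding fam_join_def by blast
  moreover from this have "X \<union> Y = (A \<union> A') \<union> (B \<union> B')" by blast
  moreover have "A \<union> A' \<in> \<A>" "B \<union> B' \<in> \<B>"
    using assms calculation unfolding union_closed_def by simp_all
  ultimately show "X \<union> Y \<in> fam_join \<A> \<B>"
    unfolding fam_join_def by blast
qed

lemma mem_fam_join_iff: "X \<in> fam_join \<A> \<B> \<longleftrightarrow> (\<exists>A\<in>\<A>. \<exists>B\<in>\<B>. X = A \<union> B)"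
  unfolding fam_join_def by blast

text \<open>Flattens nested joins into bounded quantifiers, so that associativity of the join
  reduces to \<open>Un_assoc\<close>.\<close>

lemma bex_fam_join_iff: "(\<exists>X\<in>fam_join \<A> \<B>. P X) \<longleftrightarrow> (\<exists>A\<in>\<A>. \<exists>B\<in>\<B>. P (A \<union> B))"
  unfolding Bex_def mem_fam_join_iff by blast

lemma fam_join_assoc: "fam_join (fam_join \<A> \<B>) \<C> = fam_join \<A> (fam_join \<B> \<C>)"
  by (rule set_eqI) (simp only: mem_fam_join_iff bex_fam_join_iff Un_assoc)

lemma union_closed_Unions: "union_closed {\<Union>\<S> | \<S>. \<S> \<subseteq> \<G>}"
  unfolding union_closed_def
proof (intro ballI)
  fix A B assume "A \<in> {\<Union>\<S> | \<S>. \<S> \<subseteq> \<G>}" "B \<in> {\<Union>\<S> | \<S>. \<S> \<subseteq> \<G>}"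
  then obtain \<S> \<T> where "\<S> \<subseteq> \<G>" "\<T> \<subseteq> \<G>" "A = \<Union>\<S>" "B = \<Union>\<T>" by blast
  then have "A \<union> B = \<Union>(\<S> \<union> \<T>)" "\<S> \<union> \<T> \<subseteq> \<G>" by auto
  then show "A \<union> B \<in> {\<Union>\<S> | \<S>. \<S> \<subseteq> \<G>}" by blast
qed

text \<open>Descent: a member through \<open>x\<close> that is not a generator is covered by its
  proper submembers, so \<open>x\<close> lies in a strictly smaller one; finiteness stops the
  descent.\<close>

lemma generator_through_point:
  assumes "finite A" "A \<in> \<F>" "x \<in> A" and fin: "\<And>A. A \<in> \<F> \<Longrightarrow> finite A"
  shows "\<exists>V\<in>generators \<F>. V \<subseteq> A \<and> x \<in> V"
  using assms(1-3)
proof (induction A rule: finite_psubset_induct)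
  case (psubset A)
  show ?case
  proof (cases "A \<in> generators \<F>")
    case False
    \<comment> \<open>Since \<open>x \<in> A\<close>, the set is nonempty, so it can only fail to be
      a generator through the last clause of the definition.\<close>
    then have "A = \<Union>{B \<in> \<F>. B \<subset> A}"
      using psubset.prems unfolding generators_def by auto
    then obtain B where "B \<in> \<F>" "B \<subset> A" "x \<in> B" using psubset.prems by blast
    with psubset.IH[of B] show ?thesis by blast
  qed (use psubset.prems in auto)
qed

lemma Union_generators:
  assumes "A \<in> \<F>" "\<And>A. A \<in> \<F> \<Longrightarrow> finite A"
  shows "A = \<Union>{V \<in> generators \<F>. V \<subseteq> A}"
  using generator_through_point[OF assms(2)[OF assms(1)] assms(1) _ assms(2)] by blast

text \<open>Reduces the projection to single generators, so that it differs from
  \<open>mem_fam_proj_nbhd_iff\<close> only by the condition of meeting \<open>W\<close>.\<close>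

lemma mem_fam_proj_iff:
  assumes "\<And>A. A \<in> \<F> \<Longrightarrow> finite A"
  shows "x \<in> fam_proj \<F> Z \<longleftrightarrow> (\<exists>V\<in>generators \<F>. V \<subseteq> Z \<and> x \<in> V)"
proof
  assume "x \<in> fam_proj \<F> Z"
  then obtain A where A: "A \<in> \<F>" "A \<subseteq> Z" "x \<in> A" unfolding fam_proj_def by blast
  have "\<exists>V\<in>generators \<F>. V \<subseteq> A \<and> x \<in> V"
    by (rule generator_through_point[OF assms[OF A(1)] A(1,3) assms])
  with A(2) show "\<exists>V\<in>generators \<F>. V \<subseteq> Z \<and> x \<in> V" by (meson order_trans)
qed (auto simp: fam_proj_def generators_def)

lemma generator_mem_nbhd: "V \<in> generators \<F> \<Longrightarrow> V \<inter> W \<noteq> {} \<Longrightarrow> V \<in> nbhd \<F> W"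
  unfolding nbhd_def by (intro CollectI exI[of _ "{V}"]) auto

text \<open>If a union of generators fits into \<open>Z\<close>, so does each generator in it;
  conversely one generator meeting \<open>W\<close> is itself a member of the neighbourhood.\<close>

lemma mem_fam_proj_nbhd_iff:
  "x \<in> fam_proj (nbhd \<F> W) Z \<longleftrightarrow> (\<exists>V\<in>generators \<F>. V \<inter> W \<noteq> {} \<and> V \<subseteq> Z \<and> x \<in> V)"
proof
  assume "x \<in> fam_proj (nbhd \<F> W) Z"
  then obtain \<S> where "\<S> \<subseteq> {V \<in> generators \<F>. V \<inter> W \<noteq> {}}" "\<Union>\<S> \<subseteq> Z" "x \<in> \<Union>\<S>"
    unfolding fam_proj_def nbhd_def by blast
  moreover from this obtain V where "V \<in> \<S>" "x \<in> V" by blast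
  ultimately have "V \<in> generators \<F> \<and> V \<inter> W \<noteq> {} \<and> V \<subseteq> Z \<and> x \<in> V" by auto
  then show "\<exists>V\<in>generators \<F>. V \<inter> W \<noteq> {} \<and> V \<subseteq> Z \<and> x \<in> V" by blast
next
  assume "\<exists>V\<in>generators \<F>. V \<inter> W \<noteq> {} \<and> V \<subseteq> Z \<and> x \<in> V"
  then obtain V where "V \<in> nbhd \<F> W" "V \<subseteq> Z" "x \<in> V"
    using generator_mem_nbhd by metis
  then show "x \<in> fam_proj (nbhd \<F> W) Z"
    unfolding fam_proj_def by blast
qed

lemma Union_nbhd: "\<Union>(nbhd \<F> W) = \<Union>{V \<in> generators \<F>. V \<inter> W \<noteq> {}}"
  unfolding nbhd_def by blast

lemma subset_Union_nbhd:
  assumes "\<And>A. A \<in> \<F> \<Longrightarrow> finite A" "U \<subseteq> \<Union>\<F>"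
  shows "U \<subseteq> \<Union>(nbhd \<F> U)"
proof
  fix u assume "u \<in> U"
  then obtain A where A: "A \<in> \<F>" "u \<in> A" using assms(2) by blast
  obtain V where "V \<in> generators \<F>" "u \<in> V"
    using generator_through_point[OF assms(1)[OF A(1)] A assms(1)] by blast
  with \<open>u \<in> U\<close> show "u \<in> \<Union>(nbhd \<F> U)" unfolding Union_nbhd by blast
qed

lemma ext_traces_nbhd3:
  assumes fin: "\<And>A. A \<in> \<F> \<Longrightarrow> finite A" and U: "U \<subseteq> \<Union>\<F>"
  shows "ext_traces (nbhd3 \<F> U) U X = ext_traces \<F> U X"
proof -
  \<comment> \<open>With this \<open>W\<close>, \<open>nbhd3 \<F> U\<close> is
    \<open>nbhd \<F> W\<close>, and the task is to compare projections along all generators with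
    those along generators meeting \<open>W\<close>.\<close>
  define W where "W = \<Union>(nbhd \<F> U)"
  have UW: "U \<subseteq> W" unfolding W_def by (rule subset_Union_nbhd[OF fin U])
  have meet: "V \<subseteq> W" if "V \<in> generators \<F>" "V \<inter> U \<noteq> {}" for V
    using that unfolding W_def Union_nbhd by blast
  have F_iff: "x \<in> fam_proj \<F> Z \<longleftrightarrow> (\<exists>V\<in>generators \<F>. V \<subseteq> Z \<and> x \<in> V)" for x Z
    by (rule mem_fam_proj_iff) (rule fin)
  note N_iff = mem_fam_proj_nbhd_iff[of _ \<F> W]
  have le: "fam_proj (nbhd \<F> W) Z \<subseteq> fam_proj \<F> Z" for Z
    by (auto simp: F_iff N_iff)
  \<comment> \<open>The generator witnessing \<open>x \<in> fam_proj \<F> Z\<close> meets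
    \<open>W\<close> at \<open>x\<close> itself.\<close>
  have in_W: "x \<in> fam_proj (nbhd \<F> W) Z" if "x \<in> fam_proj \<F> Z" "x \<in> W" for x Z
    using that unfolding F_iff N_iff by blast
  \<comment> \<open>This settles the first condition on \<open>Y\<close>; the second concerns points
    outside \<open>U\<close>, where the two projections may differ.\<close>
  have trace: "fam_proj (nbhd \<F> W) Z \<inter> U = fam_proj \<F> Z \<inter> U" for Z
    using le in_W UW by blast
  have "fam_proj (nbhd \<F> W) (X \<union> U) - U \<subseteq> fam_proj (nbhd \<F> W) (X \<union> Y) \<longleftrightarrow>
        fam_proj \<F> (X \<union> U) - U \<subseteq> fam_proj \<F> (X \<union> Y)" (is "?N \<longleftrightarrow> ?F") for Y
  proof
    assume N: ?N
    show ?F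
    proof
      fix x assume x: "x \<in> fam_proj \<F> (X \<union> U) - U"
      then obtain V where V: "V \<in> generators \<F>" "V \<subseteq> X \<union> U" "x \<in> V"
        unfolding Diff_iff F_iff by blast
      show "x \<in> fam_proj \<F> (X \<union> Y)"
      proof (cases "V \<inter> U = {}")
        case True
        then show ?thesis using V unfolding F_iff by blast
      next
        case False
        \<comment> \<open>By \<open>in_W\<close> the point passes to the neighbourhood projection,
          \<open>N\<close> moves it to \<open>X \<union> Y\<close>, and \<open>le\<close> brings it
          back to \<open>\<F>\<close>.\<close>
        then have "x \<in> W" using meet V by blast
        then show ?thesis using in_W x N le by blast
      qed
    qed
  next
    assume F: ?F
    show ?N
    proof
      fix x assume x: "x \<in> fam_proj (nbhd \<F> W) (X \<union> U) - U"
      then obtain V where V: "V \<in> generators \<F>" "V \<inter> W \<noteq> {}" "V \<subseteq> X \<union> U" "x \<in> V"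
        unfolding Diff_iff N_iff by blast
      show "x \<in> fam_proj (nbhd \<F> W) (X \<union> Y)"
      proof (cases "V \<inter> U = {}")
        case True
        \<comment> \<open>The same \<open>V\<close> serves as witness: it avoids \<open>U\<close>,
          hence lies in \<open>X\<close>, and it still meets \<open>W\<close>.\<close>
        then have "V \<subseteq> X \<union> Y" using V by blast
        then show ?thesis using V unfolding N_iff by blast
      next
        case False
        \<comment> \<open>The mirror image: \<open>le\<close> first, then \<open>F\<close>, and
          \<open>in_W\<close> for the return.\<close>
        then have "x \<in> W" using meet V by blast
        then show ?thesis using in_W x F le by blast
      qed
    qed
  qed
  then show ?thesis
    by (simp only: ext_traces_def nbhd3_def W_def[symmetric] trace)
qed

text \<open>A member is the union of the generators inside it, and these are sorted by whether they
  meet \<open>W\<close>. Conversely, a join is a union of generators and so stays in \<F>.\<close>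

lemma fam_join_nbhd_rest:
  assumes "finite \<F>" and fin: "\<And>A. A \<in> \<F> \<Longrightarrow> finite A" and "union_closed \<F>" "{} \<in> \<F>"
  shows "\<F> = fam_join (nbhd \<F> W) {\<Union>\<S> | \<S>. \<S> \<subseteq> {V \<in> generators \<F>. V \<inter> W = {}}}"
    (is "_ = fam_join _ ?R")
proof (intro subset_antisym subsetI)
  fix A assume "A \<in> \<F>"
  let ?S = "{V \<in> generators \<F>. V \<subseteq> A \<and> V \<inter> W \<noteq> {}}"
  let ?T = "{V \<in> generators \<F>. V \<subseteq> A \<and> V \<inter> W = {}}"
  have "A = \<Union>{V \<in> generators \<F>. V \<subseteq> A}" by (rule Union_generators[OF \<open>A \<in> \<F>\<close> fin])
  also have "{V \<in> generators \<F>. V \<subseteq> A} = ?S \<union> ?T" by auto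
  also have "\<Union>(?S \<union> ?T) = \<Union>?S \<union> \<Union>?T" by (rule Union_Un_distrib)
  finally have "A = \<Union>?S \<union> \<Union>?T" .
  moreover have "\<Union>?S \<in> nbhd \<F> W" unfolding nbhd_def by blast
  moreover have "\<Union>?T \<in> ?R" by blast
  ultimately show "A \<in> fam_join (nbhd \<F> W) ?R" unfolding fam_join_def by blast
next
  fix A assume "A \<in> fam_join (nbhd \<F> W) ?R"
  then obtain \<S> \<T> where A: "A = \<Union>\<S> \<union> \<Union>\<T>" "\<S> \<subseteq> generators \<F>" "\<T> \<subseteq> generators \<F>"
    unfolding fam_join_def nbhd_def by blast
  then have sub: "\<S> \<union> \<T> \<subseteq> \<F>" unfolding generators_def by blast
  \<comment> \<open>Finiteness of \<F> turns closure under binary unions into closure under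
    arbitrary ones, with \<open>{} \<in> \<F>\<close> covering the empty union.\<close>
  then have "\<Union>(\<S> \<union> \<T>) \<in> \<F>"
    using union_closed_Union[OF assms(3,4)] finite_subset[OF sub assms(1)] by blast
  then show "A \<in> \<F>" using A by simp
qed

lemma is_extension_nbhd:
  assumes "finite \<F>" "\<And>A. A \<in> \<F> \<Longrightarrow> finite A" "union_closed \<F>" "{} \<in> \<F>"
    and "U \<subseteq> W" "is_extension \<F>' \<F> U"
  shows "is_extension \<F>' (nbhd \<F> W) U"
proof -
  define \<R> where "\<R> = {\<Union>\<S> | \<S>. \<S> \<subseteq> {V \<in> generators \<F>. V \<inter> W = {}}}"
  obtain \<H> where H: "\<H> \<noteq> {}" "union_closed \<H>" "\<Union>\<H> \<inter> U = {}" "\<F>' = fam_join \<F> \<H>"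
    and uc: "union_closed \<F>'"
    using assms(6) unfolding is_extension_def by blast
  have "\<F> = fam_join (nbhd \<F> W) \<R>"
    unfolding \<R>_def by (rule fam_join_nbhd_rest[OF assms(1-4)])
  \<comment> \<open>Reassociation yields the new witness \<open>fam_join \<R> \<H>\<close> in place
    of \<H>.\<close>
  then have "\<F>' = fam_join (nbhd \<F> W) (fam_join \<R> \<H>)"
    using H(4) fam_join_assoc by metis
  \<comment> \<open>The empty union makes \<R> nonempty, so its join with \<H> is nonempty
    too.\<close>
  moreover have "{} \<in> \<R>" unfolding \<R>_def by blast
  then have "fam_join \<R> \<H> \<noteq> {}" using H(1) unfolding fam_join_def by blast
  moreover have "union_closed (fam_join \<R> \<H>)"
    using union_closed_fam_join H(2) union_closed_Unions unfolding \<R>_def by blast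
  moreover have "\<Union>\<R> \<inter> W = {}" unfolding \<R>_def by blast
  then have "\<Union>(fam_join \<R> \<H>) \<inter> U = {}"
    using H(3) assms(5) unfolding fam_join_def by blast
  ultimately show ?thesis unfolding is_extension_def using uc by blast
qed

theorem theorem3p12:
  fixes \<F> \<F>' :: "'a set set" and U :: "'a set"
  assumes "finite \<F>" and "\<And>A. A \<in> \<F> \<Longrightarrow> finite A"
    and "union_closed \<F>" and "{} \<in> \<F>"
    and "U \<subseteq> \<Union>\<F>"
    and "is_extension \<F>' \<F> U"
  shows "is_extension \<F>' (nbhd3 \<F> U) U \<and>
         ext_mean \<F> \<F>' U = ext_mean (nbhd3 \<F> U) \<F>' U"
proof
  show "is_extension \<F>' (nbhd3 \<F> U) U"
    unfolding nbhd3_def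
    by (rule is_extension_nbhd[OF assms(1-4) subset_Union_nbhd[OF assms(2,5)] assms(6)])
  \<comment> \<open>The index family and the denominator depend only on \<open>\<F>'\<close> and
    \<open>U\<close>, so the means agree term by term.\<close>
  show "ext_mean \<F> \<F>' U = ext_mean (nbhd3 \<F> U) \<F>' U"
    by (simp add: ext_mean_def ext_traces_nbhd3[OF assms(2,5)])
qed

end
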